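(* Let $p$ be a prime and $n\ge k\ge 1$ integers. Then $\nu_p(S(n+1,k+1))=\nu_p(S(n,k))$ if and only if $\nu_p(B_{n-k}^{(-k)})=\nu_p(B_{n-k}^{(-k)}(1))$.
   Context: $S(n,k)$ is the Stirling number of the second kind; $\nu_p$ is the $p$-adic valuation. Higher order Bernoulli polynomials $B_m^{(l)}(x)$ ($m\ge 0$, $l\in\mathbb Z$) are defined by $\left(\frac{t}{e^t-1}\right)^l e^{tx}=\sum_{m\ge 0}B_m^{(l)}(x)\frac{t^m}{m!}$, and $B_m^{(l)}=B_m^{(l)}(0)$. *)

theory Defs
  imports
    "HOL-Computational_Algebra.Computational_Algebra"
    "HOL-Combinatorics.Stirling"
    "HOL-Library.Extended_Real"
begin

text \<open>The p-adic valuation on the rationals, with value \<open>\<infinity>\<close> at 0.\<close>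

definition padic_val :: "nat \<Rightarrow> rat \<Rightarrow> ereal" where
  "padic_val p x =
     (if x = 0 then \<infinity>
      else ereal (real (multiplicity (int p) (fst (quotient_of x)))
                - real (multiplicity (int p) (snd (quotient_of x)))))"

lemma multiplicity_int: "multiplicity (int p) (int n) = multiplicity p n"
proof -
  have "int p ^ k dvd int n \<longleftrightarrow> p ^ k dvd n" for k
    by (metis of_nat_dvd_iff of_nat_power)
  then show ?thesis by (simp add: multiplicity_def)
qed

lemma padic_val_of_nat:
  assumes "n \<noteq> 0"
  shows "padic_val p (of_nat n) = ereal (real (multiplicity p n))"
proof -
  have "quotient_of (of_nat n) = (int n, 1)"
    using quotient_of_int[of "int n"] by simp
  then show ?thesis
    using assms multiplicity_int[of p n] by (simp add: padic_val_def)
qed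

text \<open>
  The series \<open>t / (e\<^sup>t - 1)\<close>. Numerator and denominator both have order 1, so the
  quotient is an honest power series with constant term 1; its integer powers
  \<open>powi\<close> are therefore true powers in the group of units of the power series ring.
\<close>

definition bernoulli_gf :: "rat fps" where
  "bernoulli_gf = fps_X / (fps_exp 1 - 1)"

lemma subdegree_fps_exp_minus_1: "subdegree (fps_exp 1 - 1 :: rat fps) = 1"
  by (rule subdegreeI) auto

lemma bernoulli_gf_mult: "bernoulli_gf * (fps_exp 1 - 1) = fps_X"
proof -
  have "(fps_exp 1 - 1 :: rat fps) dvd fps_X"
    using subdegree_fps_exp_minus_1
    by (subst fps_dvd_iff) auto
  then show ?thesis by (simp add: bernoulli_gf_def)
qed

lemma bernoulli_gf_nth_0: "fps_nth bernoulli_gf 0 = 1"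
proof -
  have "fps_nth (bernoulli_gf * (fps_exp 1 - 1)) 1 = fps_nth fps_X 1"
    by (simp only: bernoulli_gf_mult)
  then show ?thesis by (simp add: fps_mult_nth)
qed

text \<open>
  \<open>ho_bernoulli l m x\<close> is \<open>B\<^sub>m\<^bsup>(l)\<^esup>(x)\<close>: the higher order Bernoulli polynomial of order
  \<open>l\<close> and index \<open>m\<close>, evaluated at \<open>x\<close>.
\<close>

definition ho_bernoulli :: "int \<Rightarrow> nat \<Rightarrow> rat \<Rightarrow> rat" where
  "ho_bernoulli l m x = fact m * fps_nth (bernoulli_gf powi l * fps_exp x) m"

abbreviation ho_bernoulli_number :: "int \<Rightarrow> nat \<Rightarrow> rat" where
  "ho_bernoulli_number l m \<equiv> ho_bernoulli l m 0"

lemma ho_bernoulli_gf: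
  "Abs_fps (\<lambda>m. ho_bernoulli l m x / fact m) = bernoulli_gf powi l * fps_exp x"
  by (simp add: fps_eq_iff ho_bernoulli_def)

lemma ho_bernoulli_eq_poly:
  "ho_bernoulli l m x =
     poly (\<Sum>i\<le>m. monom (fact m / fact i * fps_nth (bernoulli_gf powi l) (m - i)) i) x"
proof -
  have "fps_nth (fps_exp x * bernoulli_gf powi l) m =
      (\<Sum>i\<le>m. x ^ i / fact i * fps_nth (bernoulli_gf powi l) (m - i))"
    by (simp add: fps_mult_nth atMost_atLeast0)
  then show ?thesis
    by (simp add: ho_bernoulli_def poly_sum poly_monom sum_distrib_left
        mult.commute[of "bernoulli_gf powi l"] mult_ac)
qed

end

theory Submission
  imports Defs
begin

text \<open>
  Since \<open>B\<^sub>m\<^bsup>(-k)\<^esup>(x)\<close> has generating function \<open>((e\<^sup>t - 1) / t)\<^sup>k e\<^bsup>tx\<^esup>\<close>, the exponential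
  generating function \<open>(e\<^sup>t - 1)\<^sup>k / k!\<close> of the numbers \<open>S(n,k)\<close> and its derivative give
  \<open>S(n,k) = C(n,k) B\<^bsub>n-k\<^esub>\<^bsup>(-k)\<^esup>(0)\<close> and \<open>S(n+1,k+1) = C(n,k) B\<^bsub>n-k\<^esub>\<^bsup>(-k)\<^esup>(1)\<close>. So both valuations
  on the left exceed those on the right by the same finite amount \<open>\<nu>\<^sub>p(C(n,k))\<close>.
\<close>

text \<open>Frees the valuation from the reduced fraction in \<open>padic_val\<close>:
  cross-multiplying with that fraction gives an equation of nonzero integers, where multiplicities
  at a prime add.\<close>

lemma padic_val_divide:
  assumes "prime p" "a \<noteq> 0" "b \<noteq> 0"
  shows "padic_val p (of_int a / of_int b) =
    ereal (real (multiplicity (int p) a) - real (multiplicity (int p) b))"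
proof -
  define x :: rat where "x = of_int a / of_int b"
  obtain c d where cd: "quotient_of x = (c, d)"
    by fastforce
  have d: "d > 0" and x: "x = of_int c / of_int d"
    using quotient_of_denom_pos[OF cd] quotient_of_div[OF cd] by auto
  have "x \<noteq> 0"
    using assms by (simp add: x_def)
  then have c: "c \<noteq> 0"
    using x by auto
  have "(of_int (a * d) :: rat) = of_int (c * b)"
    using x d assms by (simp add: x_def field_simps)
  then have "a * d = c * b"
    by (simp only: of_int_eq_iff)
  moreover have "prime_elem (int p)"
    using assms(1) by simp
  ultimately have "multiplicity (int p) a + multiplicity (int p) d =
      multiplicity (int p) c + multiplicity (int p) b"
    using assms c d prime_elem_multiplicity_mult_distrib
    by (metis less_irrefl)
  then show ?thesis
    using \<open>x \<noteq> 0\<close> cd by (simp add: padic_val_def flip: x_def)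
qed

lemma padic_val_mult:
  assumes "prime p"
  shows "padic_val p (x * y) = padic_val p x + padic_val p y"
proof (cases "x = 0 \<or> y = 0")
  case True
  then show ?thesis
    by (auto simp: padic_val_def)
next
  case False
  obtain a b c d where x: "x = of_int a / of_int b" "b \<noteq> 0"
    and y: "y = of_int c / of_int d" "d \<noteq> 0"
    by (metis quotient_of_div quotient_of_denom_pos surj_pair less_irrefl)
  have ac: "a \<noteq> 0" "c \<noteq> 0"
    using False x y by auto
  have "prime_elem (int p)"
    using assms by simp
  moreover have "x * y = of_int (a * c) / of_int (b * d)"
    by (simp add: x y)
  ultimately show ?thesis
    using assms x(2) y(2) ac
    by (simp add: padic_val_divide x(1) y(1) prime_elem_multiplicity_mult_distrib
        del: of_int_mult times_divide_times_eq)
qed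

text \<open>Differentiate (e^t - 1)^(k+1) and compare coefficients of t^n. This serves both the
  recurrence of the Stirling numbers and the passage to S(n+1,k+1).\<close>

lemma fps_nth_deriv_exp_minus_1_power:
  "of_nat (Suc n) * fps_nth ((fps_exp 1 - 1 :: 'a :: field_char_0 fps) ^ Suc k) (Suc n) =
    of_nat (Suc k) * fps_nth ((fps_exp 1 - 1) ^ k * fps_exp 1) n"
proof -
  have "fps_deriv ((fps_exp 1 - 1 :: 'a fps) ^ Suc k) =
      fps_const (of_nat (Suc k)) * ((fps_exp 1 - 1) ^ k * fps_exp 1)"
    by (simp add: fps_deriv_power mult_ac del: power_Suc of_nat_Suc)
  from arg_cong[OF this, of "\<lambda>f. fps_nth f n"] show ?thesis
    by (simp del: power_Suc of_nat_Suc)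
qed

text \<open>Induction along the recurrence S(n+1,k+1) = (k+1) S(n,k+1) + S(n,k), which the scaled
  coefficients on the right also satisfy.\<close>

lemma Stirling_egf:
  "of_nat (Stirling n k) =
    fact n / fact k * fps_nth ((fps_exp 1 - 1 :: 'a :: field_char_0 fps) ^ k) n"
proof (induction n k rule: Stirling.induct)
  case (4 n k)
  let ?E = "fps_exp 1 - 1 :: 'a fps"
  \<comment> \<open>Writing e^t = (e^t - 1) + 1 splits the derivative of \<open>?E ^ Suc k\<close>
    into the two terms of the recurrence.\<close>
  have "?E ^ k * fps_exp 1 = ?E ^ Suc k + ?E ^ k"
    by (simp add: algebra_simps)
  then have *: "of_nat (Suc n) * fps_nth (?E ^ Suc k) (Suc n) =
      of_nat (Suc k) * (fps_nth (?E ^ Suc k) n + fps_nth (?E ^ k) n)"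
    by (simp only: fps_nth_deriv_exp_minus_1_power fps_add_nth)
  have "fact (Suc n) / fact (Suc k) * fps_nth (?E ^ Suc k) (Suc n) =
      fact n / fact (Suc k) * (of_nat (Suc n) * fps_nth (?E ^ Suc k) (Suc n))"
    by (simp add: field_simps del: of_nat_Suc power_Suc)
  also have "\<dots> = of_nat (Suc k) * (fact n / fact (Suc k) * fps_nth (?E ^ Suc k) n) +
      fact n / fact k * fps_nth (?E ^ k) n"
    unfolding * by (simp add: field_simps del: of_nat_Suc power_Suc)
  also have "\<dots> = of_nat (Stirling (Suc n) (Suc k))"
    by (simp only: Stirling.simps of_nat_add of_nat_mult 4)
  finally show ?case ..
qed simp_all

text \<open>Since e^t - 1 is t times the inverse of \<open>bernoulli_gf\<close>, its k-th power is
  t^k times the power of order -k. The factor t^k shifts the index from n to n - k, and (n-k)!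
  C(n,k) = n!/k!.\<close>

lemma ho_bernoulli_minus:
  assumes "k \<le> n"
  shows "of_nat (n choose k) * ho_bernoulli (- int k) (n - k) x =
    fact n / fact k * fps_nth ((fps_exp 1 - 1) ^ k * fps_exp x) n"
proof -
  have inv: "inverse bernoulli_gf * bernoulli_gf = 1"
    by (rule inverse_mult_eq_1) (simp add: bernoulli_gf_nth_0)
  have "fps_exp 1 - 1 = (inverse bernoulli_gf * bernoulli_gf) * (fps_exp 1 - 1 :: rat fps)"
    by (simp add: inv)
  also have "\<dots> = inverse bernoulli_gf * fps_X"
    by (simp only: mult.assoc bernoulli_gf_mult)
  finally have "(fps_exp 1 - 1) ^ k * fps_exp x =
      fps_X ^ k * (bernoulli_gf powi (- int k) * fps_exp x)"
    by (simp add: power_int_def power_mult_distrib mult_ac)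
  then have "fps_nth ((fps_exp 1 - 1) ^ k * fps_exp x) n =
      fps_nth (bernoulli_gf powi (- int k) * fps_exp x) (n - k)"
    using assms by (simp only: fps_X_power_mult_nth) simp
  then show ?thesis
    using assms by (simp add: ho_bernoulli_def binomial_fact)
qed

lemma Stirling_eq_ho_bernoulli:
  assumes "k \<le> n"
  shows "of_nat (Stirling n k) = of_nat (n choose k) * ho_bernoulli_number (- int k) (n - k)"
  by (simp add: ho_bernoulli_minus[OF assms] Stirling_egf)

text \<open>Differentiating (e^t - 1)^(k+1) lowers both indices and leaves a factor e^t, which is
  e^(tx) at x = 1.\<close>

lemma Stirling_Suc_Suc_eq_ho_bernoulli:
  assumes "k \<le> n"
  shows "of_nat (Stirling (Suc n) (Suc k)) =
    of_nat (n choose k) * ho_bernoulli (- int k) (n - k) 1"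
proof -
  have "of_nat (Stirling (Suc n) (Suc k)) =
      fact n / fact (Suc k) *
        (of_nat (Suc n) * fps_nth ((fps_exp 1 - 1 :: rat fps) ^ Suc k) (Suc n))"
    unfolding Stirling_egf by (simp del: of_nat_Suc power_Suc)
  also have "\<dots> = fact n / fact k * fps_nth ((fps_exp 1 - 1) ^ k * fps_exp 1) n"
    unfolding fps_nth_deriv_exp_minus_1_power by (simp del: of_nat_Suc)
  finally show ?thesis
    by (simp add: ho_bernoulli_minus[OF assms])
qed

theorem theorem3p26:
  fixes p n k :: nat
  assumes "prime p" and "1 \<le> k" and "k \<le> n"
  shows "padic_val p (of_nat (Stirling (n + 1) (k + 1))) = padic_val p (of_nat (Stirling n k))
     \<longleftrightarrow> padic_val p (ho_bernoulli_number (- int k) (n - k))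
         = padic_val p (ho_bernoulli (- int k) (n - k) 1)"
proof -
  \<comment> \<open>As k \<le> n, the binomial coefficient is nonzero and its valuation finite; only
    a finite summand can be cancelled in \<open>ereal\<close>.\<close>
  obtain r where r: "padic_val p (of_nat (n choose k)) = ereal r"
    using \<open>k \<le> n\<close> padic_val_of_nat[of "n choose k" p] by auto
  show ?thesis
    unfolding Suc_eq_plus1[symmetric] Stirling_eq_ho_bernoulli[OF \<open>k \<le> n\<close>]
      Stirling_Suc_Suc_eq_ho_bernoulli[OF \<open>k \<le> n\<close>] padic_val_mult[OF \<open>prime p\<close>] r
    by (auto simp: ereal_add_cancel_left)
qed

end
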